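(* Let $\ell^{GH_N}=(\ell_1^{GH},\dots,\ell_N^{GH})'$ be an $N$-dimensional GH Lévy process with $\ell^{GH_N}(1)\sim GH_N(\lambda^{(N)},\alpha^{(N)},\beta^{(N)},\delta^{(N)},\mu^{(N)},\Gamma)$, and for $x\in\mathcal{D}$ let $(\varphi_i(x),i=1,\dots,N)$ be a sequence of non-zero coefficients. Then $(L_N^{GH}(x)(t),t\in\mathbb{T})$, where $$L_N^{GH}(x)(t):=\sum_{i=1}^N\varphi_i(x)\,\ell_i^{GH}(t),$$ is a (one-dimensional) GH Lévy process with parameters depending on $x$.
   Context: $\mathbb{T}=[0,T]$, $T>0$; $\mathcal{D}\subset\mathbb{R}^s$ is a compact domain, $s\in\mathbb{N}$; $\varphi_i(x)=\sqrt{\rho_i}\,e_i(x)$ are the components of a spectral basis evaluated at $x$. $A'$ denotes transpose and $K_\lambda$ is the modified Bessel function of the second kind with index $\lambda$. For $\lambda\in\mathbb{R}$, $\alpha>0$, $\beta,\mu\in\mathbb{R}^N$, $\delta>0$ and $\Gamma$ a symmetric positive definite $N\times N$ matrix with unit determinant, subject to $\alpha^2>\beta'\Gamma\beta$, the generalized hyperbolic distribution $GH_N(\lambda,\alpha,\beta,\delta,\mu,\Gamma)$ is the distribution on $\mathbb{R}^N$ with characteristic function $$\phi_{GH_N}(u)=e^{iu'\mu}\Big(\frac{\alpha^2-\beta'\Gamma\beta}{\alpha^2-(iu+\beta)'\Gamma(iu+\beta)}\Big)^{\lambda/2}\frac{K_\lambda\big(\delta(\alpha^2-(iu+\beta)'\Gamma(iu+\beta))^{1/2}\big)}{K_\lambda(\delta\gamma)},\qquad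 \gamma^2:=\alpha^2-\beta'\Gamma\beta .$$ It is infinitely divisible. For $N=1$ necessarily $\Gamma=1$, and one writes $GH(\lambda,\alpha,\beta,\delta,\mu)$. An $N$-dimensional GH Lévy process is a Lévy process with $\mathbb{E}(\exp(iu'\ell^{GH_N}(t)))=(\phi_{GH_N}(u))^t$. *)

theory Defs
  imports "HOL-Probability.Probability"
begin

subsection \<open>Modified Bessel functions\<close>

definition bessel_I :: "real \<Rightarrow> complex \<Rightarrow> complex" where
  "bessel_I \<nu> z =
     (\<Sum>k. rGamma (of_real \<nu> + of_nat k + 1) / fact k
           * (z / 2) powr (of_real \<nu> + 2 * of_nat k))"

(* Textbook definition of the second kind: the quotient for non-integer index, its
   limit in the index otherwise. Principal branch, i.e. z off the non-positive real axis;
   below, z always has positive real part. *)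
definition bessel_K :: "real \<Rightarrow> complex \<Rightarrow> complex" where
  "bessel_K \<nu> z =
     (let K = (\<lambda>\<eta>. of_real (pi / 2) * (bessel_I (- \<eta>) z - bessel_I \<eta> z) / of_real (sin (\<eta> * pi)))
      in if \<nu> \<in> \<int> then Lim (at \<nu>) K else K \<nu>)"

subsection \<open>The generalized hyperbolic distribution\<close>

definition pos_def_matrix :: "real ^ 'n ^ 'n \<Rightarrow> bool" where
  "pos_def_matrix A \<longleftrightarrow> transpose A = A \<and> (\<forall>v. v \<noteq> 0 \<longrightarrow> 0 < v \<bullet> (A *v v))"

definition GH_params ::
  "real \<Rightarrow> real \<Rightarrow> real ^ 'n \<Rightarrow> real \<Rightarrow> real ^ 'n \<Rightarrow> real ^ 'n ^ 'n \<Rightarrow> bool" where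
  "GH_params lam \<alpha> \<beta> \<delta> \<mu> \<Gamma> \<longleftrightarrow>
     \<alpha> > 0 \<and> \<delta> > 0 \<and> pos_def_matrix \<Gamma> \<and> det \<Gamma> = 1 \<and> \<alpha>\<^sup>2 > \<beta> \<bullet> (\<Gamma> *v \<beta>)"

(* z' A z with the plain transpose: complex bilinear, no conjugation
   (the library's inner product on complex vectors is the real one). *)
definition complex_quad_form :: "real ^ 'n ^ 'n \<Rightarrow> complex ^ 'n \<Rightarrow> complex" where
  "complex_quad_form A z = (\<Sum>j\<in>UNIV. \<Sum>k\<in>UNIV. z $ j * of_real (A $ j $ k) * z $ k)"

(* Under GH_params, q has positive real part, so principal branches of the root and of the
   power are the analytic ones. *)
definition GH_cf ::
  "real \<Rightarrow> real \<Rightarrow> real ^ 'n \<Rightarrow> real \<Rightarrow> real ^ 'n \<Rightarrow> real ^ 'n ^ 'n \<Rightarrow> real ^ 'n \<Rightarrow> complex" where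
  "GH_cf lam \<alpha> \<beta> \<delta> \<mu> \<Gamma> u =
     (let \<gamma> = sqrt (\<alpha>\<^sup>2 - \<beta> \<bullet> (\<Gamma> *v \<beta>));
          q = of_real (\<alpha>\<^sup>2) - complex_quad_form \<Gamma> (\<chi> j. \<i> * of_real (u $ j) + of_real (\<beta> $ j))
      in exp (\<i> * of_real (u \<bullet> \<mu>))
         * (of_real (\<alpha>\<^sup>2 - \<beta> \<bullet> (\<Gamma> *v \<beta>)) / q) powr of_real (lam / 2)
         * (bessel_K lam (of_real \<delta> * csqrt q) / bessel_K lam (of_real (\<delta> * \<gamma>))))"

subsection \<open>Levy processes on a bounded time interval\<close>

definition levy_process ::
  "'w measure \<Rightarrow> real \<Rightarrow> (real \<Rightarrow> 'w \<Rightarrow> 'b::euclidean_space) \<Rightarrow> bool" where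
  "levy_process M T X \<longleftrightarrow>
     prob_space M \<and>
     (\<forall>t\<in>{0..T}. X t \<in> borel_measurable M) \<and>
     (AE \<omega> in M. X 0 \<omega> = 0) \<and>
     (\<forall>(n::nat) t. 0 \<le> t 0 \<longrightarrow> (\<forall>i<n. t i < t (Suc i)) \<longrightarrow> t n \<le> T \<longrightarrow>
        prob_space.indep_vars M (\<lambda>_. borel) (\<lambda>i \<omega>. X (t (Suc i)) \<omega> - X (t i) \<omega>) {..<n}) \<and>
     (\<forall>s t h. 0 \<le> s \<longrightarrow> s \<le> t \<longrightarrow> 0 \<le> h \<longrightarrow> t + h \<le> T \<longrightarrow>
        distr M borel (\<lambda>\<omega>. X (t + h) \<omega> - X (s + h) \<omega>) = distr M borel (\<lambda>\<omega>. X t \<omega> - X s \<omega>)) \<and>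
     (\<forall>t\<in>{0..T}. \<forall>\<epsilon>>0.
        ((\<lambda>s. measure M {\<omega> \<in> space M. norm (X s \<omega> - X t \<omega>) > \<epsilon>}) \<longlongrightarrow> 0) (at t within {0..T}))"

definition char_fun :: "'w measure \<Rightarrow> ('w \<Rightarrow> 'b::euclidean_space) \<Rightarrow> 'b \<Rightarrow> complex" where
  "char_fun M Y u = integral\<^sup>L M (\<lambda>\<omega>. exp (\<i> * of_real (u \<bullet> Y \<omega>)))"

(* The continuous logarithm vanishing at 0; it is unique if it exists. The power
   \<phi>(u)^t of an infinitely divisible characteristic function means exp (t * \<psi> u); the principal
   power would in general be wrong, since the argument of \<phi> may leave (-pi, pi]. *)
definition distinguished_log ::
  "('b::euclidean_space \<Rightarrow> complex) \<Rightarrow> ('b \<Rightarrow> complex) \<Rightarrow> bool" where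
  "distinguished_log \<phi> \<psi> \<longleftrightarrow>
     continuous_on UNIV \<psi> \<and> \<psi> 0 = 0 \<and> (\<forall>u. exp (\<psi> u) = \<phi> u)"

definition GH_levy_process ::
  "'w measure \<Rightarrow> real \<Rightarrow> real \<Rightarrow> real \<Rightarrow> real ^ 'n \<Rightarrow> real \<Rightarrow> real ^ 'n \<Rightarrow> real ^ 'n ^ 'n \<Rightarrow>
   (real \<Rightarrow> 'w \<Rightarrow> real ^ 'n) \<Rightarrow> bool" where
  "GH_levy_process M T lam \<alpha> \<beta> \<delta> \<mu> \<Gamma> X \<longleftrightarrow>
     GH_params lam \<alpha> \<beta> \<delta> \<mu> \<Gamma> \<and> levy_process M T X \<and>
     (\<exists>\<psi>. distinguished_log (GH_cf lam \<alpha> \<beta> \<delta> \<mu> \<Gamma>) \<psi> \<and>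
          (\<forall>t\<in>{0..T}. \<forall>u. char_fun M (X t) u = exp (of_real t * \<psi> u)))"

lemma GH_levy_process_at_1:
  assumes "GH_levy_process M T lam \<alpha> \<beta> \<delta> \<mu> \<Gamma> X" "1 \<le> T"
  shows "char_fun M (X 1) u = GH_cf lam \<alpha> \<beta> \<delta> \<mu> \<Gamma> u"
  using assms by (auto simp: GH_levy_process_def distinguished_log_def)

(* The case N = 1 (where necessarily \<Gamma> = 1), for a real-valued process. *)
definition GH_levy_process_1 ::
  "'w measure \<Rightarrow> real \<Rightarrow> real \<Rightarrow> real \<Rightarrow> real \<Rightarrow> real \<Rightarrow> real \<Rightarrow> (real \<Rightarrow> 'w \<Rightarrow> real) \<Rightarrow> bool" where
  "GH_levy_process_1 M T lam \<alpha> \<beta> \<delta> \<mu> Y \<longleftrightarrow>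
     GH_levy_process M T lam \<alpha> (vec \<beta> :: real ^ 1) \<delta> (vec \<mu>) (mat 1) (\<lambda>t \<omega>. vec (Y t \<omega>))"

end

theory Submission
  imports Defs
begin

text \<open>
  The characteristic function of a linear image \<open>a \<bullet> X\<close> at \<open>u\<close> is that of \<open>X\<close> at \<open>u a\<close>.
  With \<open>c = a'\<Gamma>a > 0\<close>, the quadratic expression under the root in the GH characteristic function
  at \<open>u a\<close> is
  \<open>\<alpha>\<^sup>2 - \<beta>'\<Gamma>\<beta> + c u\<^sup>2 - 2 i u a'\<Gamma>\<beta> = c (\<alpha>\<^sub>1\<^sup>2 - (i u + \<beta>\<^sub>1)\<^sup>2)\<close> where \<open>\<beta>\<^sub>1 = a'\<Gamma>\<beta> / c\<close> and
  \<open>\<alpha>\<^sub>1\<^sup>2 - \<beta>\<^sub>1\<^sup>2 = (\<alpha>\<^sup>2 - \<beta>'\<Gamma>\<beta>) / c\<close>. The factor \<open>c\<close> cancels in the quotient and is absorbed by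
  \<open>\<delta>\<^sub>1 = \<delta> \<surd>c\<close> in the Bessel functions; the index is unchanged and \<open>\<mu>\<^sub>1 = a'\<mu>\<close>.
\<close>

text \<open>Increments of the image process are images under \<open>f\<close> of increments of
  \<open>X\<close>. So independence passes through composition with a measurable map, equality of
  increment laws through push-forward, and stochastic continuity through the bound on
  \<open>f\<close>.\<close>

lemma levy_process_bounded_linear:
  fixes f :: "'b::euclidean_space \<Rightarrow> 'c::euclidean_space"
  assumes X: "levy_process M T X" and f: "bounded_linear f"
  shows "levy_process M T (\<lambda>t \<omega>. f (X t \<omega>))"
proof -
  interpret f: bounded_linear f by fact
  interpret prob_space M using X by (simp add: levy_process_def)
  have meas [measurable]: "X t \<in> borel_measurable M" if "t \<in> {0..T}" for t
    using X that by (simp add: levy_process_def)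
  have f_meas [measurable]: "f \<in> borel_measurable borel"
    by (intro borel_measurable_continuous_onI f.continuous_on continuous_on_id)
  have "AE \<omega> in M. f (X 0 \<omega>) = 0"
    using X by (auto simp: levy_process_def f.zero)
  moreover have "indep_vars (\<lambda>_. borel) (\<lambda>i \<omega>. f (X (t (Suc i)) \<omega>) - f (X (t i) \<omega>)) {..<n}"
    if "0 \<le> t 0" "\<forall>i<n. t i < t (Suc i)" "t n \<le> T" for n :: nat and t
  proof -
    have "indep_vars (\<lambda>_. borel) (\<lambda>i \<omega>. X (t (Suc i)) \<omega> - X (t i) \<omega>) {..<n}"
      using X that by (simp add: levy_process_def)
    from indep_vars_compose2[OF this, of "\<lambda>_. f"] show ?thesis
      by (simp add: f.diff)
  qed
  moreover have "distr M borel (\<lambda>\<omega>. f (X (t + h) \<omega>) - f (X (s + h) \<omega>)) =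
      distr M borel (\<lambda>\<omega>. f (X t \<omega>) - f (X s \<omega>))"
    if "0 \<le> s" "s \<le> t" "0 \<le> h" "t + h \<le> T" for s t h
  proof -
    have image: "distr M borel (\<lambda>\<omega>. f (X v \<omega>) - f (X r \<omega>)) =
        distr (distr M borel (\<lambda>\<omega>. X v \<omega> - X r \<omega>)) borel f"
      if "r \<in> {0..T}" "v \<in> {0..T}" for r v
      using that by (subst distr_distr) (auto simp: f.diff o_def)
    have "distr M borel (\<lambda>\<omega>. X (t + h) \<omega> - X (s + h) \<omega>) = distr M borel (\<lambda>\<omega>. X t \<omega> - X s \<omega>)"
      using X that by (simp add: levy_process_def)
    then show ?thesis
      using that by (simp add: image)
  qed
  moreover have "((\<lambda>s. measure M {\<omega> \<in> space M. norm (f (X s \<omega>) - f (X t \<omega>)) > \<epsilon>}) \<longlongrightarrow> 0)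
      (at t within {0..T})"
    if t: "t \<in> {0..T}" and "\<epsilon> > 0" for t \<epsilon>
  proof -
    \<comment> \<open>A deviation above \<epsilon> after applying \<open>f\<close> forces one above
      \<open>\<epsilon> / K\<close> before it, so the probabilities are squeezed between 0 and a
      null limit.\<close>
    obtain K where "K > 0" and K: "\<And>x. norm (f x) \<le> norm x * K"
      using f.pos_bounded by blast
    have lim: "((\<lambda>s. measure M {\<omega> \<in> space M. norm (X s \<omega> - X t \<omega>) > \<epsilon> / K}) \<longlongrightarrow> 0)
        (at t within {0..T})"
      using X t \<open>\<epsilon> > 0\<close> \<open>K > 0\<close> by (simp add: levy_process_def)
    have "measure M {\<omega> \<in> space M. norm (f (X s \<omega>) - f (X t \<omega>)) > \<epsilon>} \<le>
        measure M {\<omega> \<in> space M. norm (X s \<omega> - X t \<omega>) > \<epsilon> / K}" if "s \<in> {0..T}" for s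
    proof (rule finite_measure_mono)
      show "{\<omega> \<in> space M. norm (X s \<omega> - X t \<omega>) > \<epsilon> / K} \<in> sets M"
        using that t by measurable
      show "{\<omega> \<in> space M. norm (f (X s \<omega>) - f (X t \<omega>)) > \<epsilon>} \<subseteq>
          {\<omega> \<in> space M. norm (X s \<omega> - X t \<omega>) > \<epsilon> / K}"
        using \<open>K > 0\<close> K by (auto simp: f.diff[symmetric] divide_less_eq intro: less_le_trans)
    qed
    then show ?thesis
      by (intro tendsto_sandwich[OF _ _ tendsto_const lim])
        (auto simp: eventually_at_filter intro!: always_eventually)
  qed
  ultimately show ?thesis
    using prob_space_axioms f_meas by (simp add: levy_process_def)
qed

lemma inner_matrix_vector_sum:
  fixes A :: "real ^ 'n ^ 'n"
  shows "x \<bullet> (A *v y) = (\<Sum>j\<in>UNIV. \<Sum>k\<in>UNIV. x $ j * A $ j $ k * y $ k)"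
  by (simp add: inner_vec_def matrix_vector_mult_def sum_distrib_left mult.assoc)

lemma inner_symmetric_matrix:
  fixes A :: "real ^ 'n ^ 'n"
  assumes "transpose A = A"
  shows "x \<bullet> (A *v y) = y \<bullet> (A *v x)"
  using assms by (metis dot_lmul_matrix inner_commute transpose_matrix_vector)

text \<open>The form is bilinear without conjugation, so the factor \<open>\<i>\<close> squared
  turns the sign of the \<open>u\<close> term; symmetry of \<open>A\<close> merges the two mixed
  terms into one imaginary part.\<close>

lemma complex_quad_form_Complex:
  fixes A :: "real ^ 'n ^ 'n"
  assumes "transpose A = A"
  shows "complex_quad_form A (\<chi> j. \<i> * of_real (u $ j) + of_real (\<beta> $ j)) =
    Complex (\<beta> \<bullet> (A *v \<beta>) - u \<bullet> (A *v u)) (2 * (u \<bullet> (A *v \<beta>)))"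
proof -
  let ?z = "(\<chi> j. \<i> * of_real (u $ j) + of_real (\<beta> $ j)) :: complex ^ 'n"
  have "?z $ j * of_real (A $ j $ k) * ?z $ k =
      Complex (\<beta> $ j * A $ j $ k * \<beta> $ k - u $ j * A $ j $ k * u $ k)
        (u $ j * A $ j $ k * \<beta> $ k + \<beta> $ j * A $ j $ k * u $ k)" for j k
    by (simp add: complex_eq_iff algebra_simps)
  then have "complex_quad_form A ?z =
      Complex (\<beta> \<bullet> (A *v \<beta>) - u \<bullet> (A *v u)) (u \<bullet> (A *v \<beta>) + \<beta> \<bullet> (A *v u))"
    unfolding complex_quad_form_def inner_matrix_vector_sum
    by (simp only:) (simp add: complex_eq_iff sum.distrib sum_subtractf)
  then show ?thesis
    by (simp add: inner_symmetric_matrix[OF assms, of \<beta> u])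
qed

text \<open>A positive factor leaves the argument of \<open>z\<close> unchanged, so no branch cut is
  crossed. This is what lets a scaling under the root move into the parameter \<delta>.\<close>

lemma csqrt_of_real_mult:
  assumes "c \<ge> 0"
  shows "csqrt (of_real c * z) = of_real (sqrt c) * csqrt z"
proof (cases "c = 0 \<or> z = 0")
  case False
  then have "c > 0" "z \<noteq> 0" using assms by auto
  show ?thesis
  proof (rule csqrt_unique)
    show "(of_real (sqrt c) * csqrt z)\<^sup>2 = of_real c * z"
      using assms by (simp add: power_mult_distrib flip: of_real_power)
    show "0 < Re (of_real (sqrt c) * csqrt z) \<or>
        Re (of_real (sqrt c) * csqrt z) = 0 \<and> 0 \<le> Im (of_real (sqrt c) * csqrt z)"
      using csqrt_principal[of z] \<open>c > 0\<close> by (auto simp: zero_less_mult_iff)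
  qed
qed auto

text \<open>Only the square of \<open>\<alpha>1\<close> is prescribed, because \<open>GH_cf\<close>
  depends on it through its square alone.\<close>

lemma GH_cf_linear_image:
  fixes a \<beta> \<mu> :: "real ^ 'n" and \<Gamma> :: "real ^ 'n ^ 'n" and v :: "real ^ 1"
  assumes sym: "transpose \<Gamma> = \<Gamma>"
  defines "c \<equiv> a \<bullet> (\<Gamma> *v a)"
  defines "\<beta>1 \<equiv> a \<bullet> (\<Gamma> *v \<beta>) / c"
  assumes "c > 0" and \<alpha>1: "\<alpha>1\<^sup>2 = (\<alpha>\<^sup>2 - \<beta> \<bullet> (\<Gamma> *v \<beta>)) / c + \<beta>1\<^sup>2"
  shows "GH_cf lam \<alpha>1 (vec \<beta>1) (\<delta> * sqrt c) (vec (a \<bullet> \<mu>)) (mat 1) v =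
    GH_cf lam \<alpha> \<beta> \<delta> \<mu> \<Gamma> (v $ 1 *\<^sub>R a)"
proof -
  define g where "g = \<alpha>\<^sup>2 - \<beta> \<bullet> (\<Gamma> *v \<beta>)"
  define q where "q = of_real (\<alpha>\<^sup>2) -
    complex_quad_form \<Gamma> (\<chi> j. \<i> * of_real ((v $ 1 *\<^sub>R a) $ j) + of_real (\<beta> $ j))"
  define q1 where "q1 = of_real (\<alpha>1\<^sup>2) -
    complex_quad_form (mat 1 :: real ^ 1 ^ 1) (\<chi> j. \<i> * of_real (v $ j) + of_real (vec \<beta>1 $ j))"
  have inner1: "x \<bullet> y = x $ 1 * y $ 1" for x y :: "real ^ 1"
    by (simp add: inner_vec_def)
  have g1: "\<alpha>1\<^sup>2 - vec \<beta>1 \<bullet> ((mat 1 :: real ^ 1 ^ 1) *v vec \<beta>1) = g / c"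
    by (simp add: inner1 \<alpha>1 g_def flip: power2_eq_square)
  have q: "q = Complex (g + (v $ 1)\<^sup>2 * c) (- (2 * v $ 1 * (a \<bullet> (\<Gamma> *v \<beta>))))"
    unfolding q_def complex_quad_form_Complex[OF sym]
    by (simp add: complex_eq_iff g_def c_def matrix_vector_mult_scaleR power2_eq_square)
  have "q1 = Complex (g / c + (v $ 1)\<^sup>2) (- (2 * v $ 1 * \<beta>1))"
    unfolding q1_def complex_quad_form_Complex[OF transpose_mat]
    by (simp add: complex_eq_iff \<alpha>1 g_def inner1 flip: power2_eq_square)
  then have q_eq: "q = of_real c * q1"
    using \<open>c > 0\<close> unfolding q \<beta>1_def by (simp add: complex_eq_iff field_simps)
  \<comment> \<open>The four equalities from here on match, in turn, the base of the power, the
    Bessel argument in the numerator, the one in the denominator, and the exponent of the drift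
    factor. In the first, \<open>c\<close> cancels before the power is taken, so the branch is not
    affected.\<close>
  have "of_real (g / c) / q1 = of_real g / q"
    using \<open>c > 0\<close> by (simp add: q_eq)
  moreover have "of_real (\<delta> * sqrt c) * csqrt q1 = of_real \<delta> * csqrt q"
    using \<open>c > 0\<close> by (simp add: q_eq csqrt_of_real_mult)
  moreover have "\<delta> * sqrt c * sqrt (g / c) = \<delta> * sqrt g"
    using \<open>c > 0\<close> by (simp add: real_sqrt_divide)
  moreover have "v \<bullet> vec (a \<bullet> \<mu>) = (v $ 1 *\<^sub>R a) \<bullet> \<mu>"
    by (simp add: inner1)
  ultimately show ?thesis
    unfolding GH_cf_def Let_def g1 q_def[symmetric] q1_def[symmetric] g_def[symmetric]
    by metis
qed

lemma GH_levy_process_1_inner: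
  fixes a \<beta> \<mu> :: "real ^ 'n" and \<Gamma> :: "real ^ 'n ^ 'n"
  assumes L: "GH_levy_process M T lam \<alpha> \<beta> \<delta> \<mu> \<Gamma> L" and "a \<noteq> 0"
  defines "c \<equiv> a \<bullet> (\<Gamma> *v a)"
  defines "\<beta>1 \<equiv> a \<bullet> (\<Gamma> *v \<beta>) / c"
  defines "\<alpha>1 \<equiv> sqrt ((\<alpha>\<^sup>2 - \<beta> \<bullet> (\<Gamma> *v \<beta>)) / c + \<beta>1\<^sup>2)"
  shows "GH_levy_process_1 M T lam \<alpha>1 \<beta>1 (\<delta> * sqrt c) (a \<bullet> \<mu>) (\<lambda>t \<omega>. a \<bullet> L t \<omega>)"
proof -
  have par: "\<delta> > 0" "\<alpha>\<^sup>2 > \<beta> \<bullet> (\<Gamma> *v \<beta>)" and sym: "transpose \<Gamma> = \<Gamma>" and c: "c > 0"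
    using L \<open>a \<noteq> 0\<close> by (auto simp: GH_levy_process_def GH_params_def pos_def_matrix_def c_def)
  have "(\<alpha>\<^sup>2 - \<beta> \<bullet> (\<Gamma> *v \<beta>)) / c > 0"
    using c par by simp
  \<comment> \<open>This is the constraint \<open>\<alpha>1\<^sup>2 > \<beta>1\<^sup>2\<close> of
    the one-dimensional law; it also makes the radicand defining \<open>\<alpha>1\<close>
    positive.\<close>
  then have pos: "(\<alpha>\<^sup>2 - \<beta> \<bullet> (\<Gamma> *v \<beta>)) / c + \<beta>1\<^sup>2 > \<beta>1\<^sup>2"
    by simp
  then have \<alpha>1_sq: "\<alpha>1\<^sup>2 = (\<alpha>\<^sup>2 - \<beta> \<bullet> (\<Gamma> *v \<beta>)) / c + \<beta>1\<^sup>2" and "\<alpha>1 > 0"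
    using zero_le_power2[of \<beta>1] unfolding \<alpha>1_def by (auto intro: less_le_trans)
  then have params: "GH_params lam \<alpha>1 (vec \<beta>1 :: real ^ 1) (\<delta> * sqrt c) (vec (a \<bullet> \<mu>)) (mat 1)"
    using par c pos
    by (simp add: GH_params_def pos_def_matrix_def transpose_mat inner_vec_def[of "vec \<beta>1"]
        power2_eq_square)
  \<comment> \<open>The scalar is wrapped by \<open>vec\<close> because
    \<open>GH_levy_process_1\<close> is stated through \<open>real ^ 1\<close>.\<close>
  have "bounded_linear (\<lambda>y. vec (a \<bullet> y) :: real ^ 1)"
    by (intro linear_conv_bounded_linear[THEN iffD1] linearI)
      (simp_all add: vec_eq_iff inner_add_right)
  then have levy: "levy_process M T (\<lambda>t \<omega>. vec (a \<bullet> L t \<omega>) :: real ^ 1)"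
    using L levy_process_bounded_linear unfolding GH_levy_process_def by blast
  obtain \<psi> where \<psi>: "distinguished_log (GH_cf lam \<alpha> \<beta> \<delta> \<mu> \<Gamma>) \<psi>"
    and cf: "\<And>t u. t \<in> {0..T} \<Longrightarrow> char_fun M (L t) u = exp (of_real t * \<psi> u)"
    using L by (auto simp: GH_levy_process_def)
  \<comment> \<open>Composing \<psi> with the continuous linear map
    \<open>v \<mapsto> v $ 1 *\<^sub>R a\<close> keeps continuity and the value 0 at 0. So
    \<open>\<psi>1\<close> is the distinguished logarithm of the new characteristic function, and
    the formula for every \<open>t\<close> is inherited.\<close>
  define \<psi>1 where "\<psi>1 = (\<lambda>v :: real ^ 1. \<psi> (v $ 1 *\<^sub>R a))"
  have "continuous_on UNIV (\<lambda>v :: real ^ 1. v $ 1 *\<^sub>R a)"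
    by (intro continuous_intros)
  then have "continuous_on UNIV \<psi>1"
    using \<psi> unfolding \<psi>1_def distinguished_log_def
    by (auto intro: continuous_on_compose2[of UNIV \<psi>])
  moreover have "GH_cf lam \<alpha>1 (vec \<beta>1) (\<delta> * sqrt c) (vec (a \<bullet> \<mu>)) (mat 1) v =
      GH_cf lam \<alpha> \<beta> \<delta> \<mu> \<Gamma> (v $ 1 *\<^sub>R a)" for v :: "real ^ 1"
    using GH_cf_linear_image[OF sym c[unfolded c_def] \<alpha>1_sq[unfolded \<beta>1_def c_def]]
    unfolding \<beta>1_def c_def .
  ultimately have log: "distinguished_log
      (GH_cf lam \<alpha>1 (vec \<beta>1) (\<delta> * sqrt c) (vec (a \<bullet> \<mu>)) (mat 1)) \<psi>1"
    using \<psi> by (simp add: distinguished_log_def \<psi>1_def)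
  have "char_fun M (\<lambda>\<omega>. vec (a \<bullet> L t \<omega>) :: real ^ 1) v = char_fun M (L t) (v $ 1 *\<^sub>R a)" for t v
    by (simp add: char_fun_def inner_vec_def[of v])
  then show ?thesis
    using params levy log cf
    unfolding GH_levy_process_1_def GH_levy_process_def by (auto simp: \<psi>1_def)
qed

theorem lemma4p9:
  fixes M :: "'w measure" and T :: real and D :: "(real ^ 's) set"
    and \<rho> :: "'n::finite \<Rightarrow> real" and e :: "'n \<Rightarrow> real ^ 's \<Rightarrow> real"
    and \<phi> :: "'n \<Rightarrow> real ^ 's \<Rightarrow> real"
    and lamN \<alpha>N \<delta>N :: real and \<beta>N \<mu>N :: "real ^ 'n" and \<Gamma> :: "real ^ 'n ^ 'n"
    and L :: "real \<Rightarrow> 'w \<Rightarrow> real ^ 'n"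
  assumes "T > 0"
    and "compact D"
    and "\<And>i. \<rho> i \<ge> 0"
    and "\<And>i x. x \<in> D \<Longrightarrow> \<phi> i x = sqrt (\<rho> i) * e i x"
    and "GH_levy_process M T lamN \<alpha>N \<beta>N \<delta>N \<mu>N \<Gamma> L"
  shows "\<exists>lam \<alpha> \<beta> \<delta> \<mu> :: real ^ 's \<Rightarrow> real.
           \<forall>x\<in>D. (\<forall>i. \<phi> i x \<noteq> 0) \<longrightarrow>
             GH_levy_process_1 M T (lam x) (\<alpha> x) (\<beta> x) (\<delta> x) (\<mu> x)
               (\<lambda>t \<omega>. \<Sum>i\<in>UNIV. \<phi> i x * L t \<omega> $ i)"
proof -
  \<comment> \<open>Index types are nonempty, so a vector with no zero component is nonzero.\<close>
  have nz: "(\<chi> i. \<phi> i x) \<noteq> 0" if "\<forall>i. \<phi> i x \<noteq> 0" for x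
    using that by (simp add: vec_eq_iff)
  have inner: "(\<lambda>t \<omega>. \<Sum>i\<in>UNIV. \<phi> i x * L t \<omega> $ i) = (\<lambda>t \<omega>. (\<chi> i. \<phi> i x) \<bullet> L t \<omega>)" for x
    by (simp add: inner_vec_def)
  show ?thesis
    \<comment> \<open>The parameter functions stay schematic in \<open>x\<close>; unification with
      the conclusion of the rule, at the coefficient vector of \<open>x\<close>, supplies
      them.\<close>
    unfolding inner by (intro exI ballI impI) (rule GH_levy_process_1_inner[OF assms(5) nz])
qed

end
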